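(* $$\left(\sum_{n\ 3\text{-free}}\frac{1}{n^3}\right)\left(\sum_{n\ 3\text{-free}}\frac{\mu_3(n)}{n^3}\right)=\frac{41247931725}{43867\,\pi^{12}},$$ where both sums are over all positive integers $n$ that are $3$-free.
   Context: A positive integer $n$ is called $3$-free if there is no prime $p$ such that $p^3$ divides $n$. The Möbius function of rank $3$ is the arithmetic function $\mu_3:\{1,2,3,\dots\}\to\{-1,0,1\}$ defined by $\mu_3(1)=1$; $\mu_3(n)=(-1)^{m_1+\cdots+m_k}$ if $n=p_1^{m_1}\cdots p_k^{m_k}$ (distinct primes $p_j$, all $m_j\ge 1$) with all $m_j<3$; and $\mu_3(n)=0$ if $p^3\mid n$ for some prime $p$. *)

theory Defs
  imports "HOL-Analysis.Analysis" "HOL-Computational_Algebra.Primes"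
begin

definition three_free :: "nat \<Rightarrow> bool" where
  "three_free n \<longleftrightarrow> n > 0 \<and> \<not> (\<exists>p. prime p \<and> p ^ 3 dvd n)"

(* The arithmetic function is meant on positive integers; the junk value at 0 is 0.
   At 1 the sum of exponents is empty, so the value is 1. *)
definition mu3 :: "nat \<Rightarrow> int" where
  "mu3 n = (if \<exists>p. prime p \<and> p ^ 3 dvd n then 0
            else (-1) ^ (\<Sum>p\<in>prime_factors n. multiplicity p n))"

end

theory Submission
  imports Defs "HOL-Complex_Analysis.Laurent_Convergence"
begin

text \<open>
  Write \<open>x = p\<^sup>-\<^sup>3\<close>. A three-free number carries each prime with exponent 0, 1 or 2, so the two
  series have Euler factors \<open>1 + x + x\<^sup>2\<close> and \<open>1 - x + x\<^sup>2\<close>, because on three-free numbers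
  \<open>\<mu>\<^sub>3\<close> is the completely multiplicative function that sends every prime to \<open>-1\<close>. The product
  of the two factors is
  \[ 1 + x^2 + x^4 = \frac{1 - x^6}{1 - x^2}, \]
  and therefore the product of the two series is \<open>\<zeta>(6) / \<zeta>(18)\<close>; this is the
  case \<open>s = 3\<close> of \<open>three_free_sums_eq_zeta_quotient\<close>, where the denominator is multiplied out.

  The two zeta values come from the partial fraction expansion of the cotangent, which is the
  logarithmic derivative of Euler's reflection formula for the Gamma function. Expanding each
  partial fraction as a geometric series shows that
  \[ \sum_{j \ge 1} \zeta(2j) x^{2j} = \frac{1 - \pi x \cot(\pi x)}{2}. \]
  After multiplication by \<open>sin (\<pi> x)\<close> both sides are power series with known coefficients
  apart from the zeta values, and comparing them gives a linear recurrence for the rational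
  numbers \<open>\<zeta>(2k) / \<pi>\<^sup>2\<^sup>k\<close> (lemma \<open>zeta_even_recurrence\<close>). Nine steps of it reach \<open>\<zeta>(18)\<close>.
\<close>

section \<open>Euler products\<close>

definition smooth_numbers :: "nat set \<Rightarrow> nat set" where
  "smooth_numbers P = {n. n > 0 \<and> prime_factors n \<subseteq> P}"

text \<open>
  Splitting off the exact power of \<open>p\<close> is what turns a sum over \<open>P \<union> {p}\<close>-smooth numbers into
  a product of a sum over powers of \<open>p\<close> and a sum over \<open>P\<close>-smooth numbers.
\<close>

lemma bij_betw_smooth_numbers_insert:
  assumes P: "\<forall>q\<in>insert p P. prime q" and p: "p \<notin> P"
  shows "bij_betw (\<lambda>(k, m). p ^ k * m) (UNIV \<times> smooth_numbers P) (smooth_numbers (insert p P))"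
proof (rule bij_betwI[where g = "\<lambda>n. (multiplicity p n, n div p ^ multiplicity p n)"])
  have pp: "prime p" using P by auto
  have ndvd: "\<not> p dvd m" if "m \<in> smooth_numbers P" for m
    using that pp p by (auto simp: smooth_numbers_def prime_factors_dvd)
  show "(\<lambda>(k, m). p ^ k * m) \<in> UNIV \<times> smooth_numbers P \<rightarrow> smooth_numbers (insert p P)"
    using pp by (auto simp: smooth_numbers_def prime_factorization_mult prime_factorization_prime_power
        prime_gt_0_nat split: if_splits)
  show "(\<lambda>n. (multiplicity p n, n div p ^ multiplicity p n))
          \<in> smooth_numbers (insert p P) \<rightarrow> UNIV \<times> smooth_numbers P"
  proof
    fix n assume n: "n \<in> smooth_numbers (insert p P)"
    define m where "m = n div p ^ multiplicity p n"
    have nm: "n = p ^ multiplicity p n * m"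
      unfolding m_def by (simp add: multiplicity_dvd)
    have "n > 0" using n by (simp add: smooth_numbers_def)
    then have m0: "m > 0" using nm by (metis gr0I mult_0_right)
    have "p \<notin> prime_factors m"
      using multiplicity_decompose[of n p] \<open>n > 0\<close> pp
      by (auto simp: m_def prime_nat_iff dest: in_prime_factors_imp_dvd)
    moreover have "prime_factors m \<subseteq> prime_factors n"
      using \<open>n > 0\<close> dvd_triv_right[of m "p ^ multiplicity p n"]
      by (intro dvd_prime_factors) (auto simp flip: nm)
    moreover have "prime_factors n \<subseteq> insert p P"
      using n by (simp add: smooth_numbers_def)
    ultimately have "prime_factors m \<subseteq> P" by blast
    then have "m \<in> smooth_numbers P"
      using m0 by (simp add: smooth_numbers_def)
    then show "(multiplicity p n, n div p ^ multiplicity p n) \<in> UNIV \<times> smooth_numbers P"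
      by (simp add: m_def)
  qed
  show "(multiplicity p (case x of (k, m) \<Rightarrow> p ^ k * m),
         (case x of (k, m) \<Rightarrow> p ^ k * m) div p ^ multiplicity p (case x of (k, m) \<Rightarrow> p ^ k * m)) = x"
    if x: "x \<in> UNIV \<times> smooth_numbers P" for x
  proof -
    obtain k m where km: "x = (k, m)" "m \<in> smooth_numbers P" using x by auto
    have "multiplicity p (p ^ k * m) = k"
      using ndvd[OF km(2)] pp by (intro multiplicity_decomposeI[of _ _ _ m]) (auto simp: prime_nat_iff)
    then show ?thesis using km pp by (simp add: prime_gt_0_nat)
  qed
  show "(case (multiplicity p n, n div p ^ multiplicity p n) of (k, m) \<Rightarrow> p ^ k * m) = n"
    if "n \<in> smooth_numbers (insert p P)" for n
    by (simp add: multiplicity_dvd)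
qed

text \<open>
  Induction on \<open>P\<close>: with \<open>n = p\<^sup>k m\<close> and multiplicativity, summing first over \<open>m\<close> and then over \<open>k\<close>
  adds one factor. Summability on all positive integers justifies the iterated summation.
\<close>

lemma euler_product_finite:
  fixes f :: "nat \<Rightarrow> real"
  assumes one: "f 1 = 1"
    and mult: "\<And>a b. a > 0 \<Longrightarrow> b > 0 \<Longrightarrow> coprime a b \<Longrightarrow> f (a * b) = f a * f b"
    and summable: "f summable_on {0<..}"
    and "finite P" "\<forall>p\<in>P. prime p"
  shows "(f has_sum (\<Prod>p\<in>P. \<Sum>\<^sub>\<infinity>k. f (p ^ k))) (smooth_numbers P)"
  using assms(4,5)
proof (induction P)
  case empty
  have "smooth_numbers {} = {1}"
    by (auto simp: smooth_numbers_def prime_factorization_empty_iff)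
  then show ?case using has_sum_finite[of "{1::nat}" f] one by simp
next
  case (insert p P)
  have pp: "prime p" using insert.prems by auto
  define c where "c = (\<Prod>p\<in>P. \<Sum>\<^sub>\<infinity>k. f (p ^ k))"
  have IH: "(f has_sum c) (smooth_numbers P)" using insert unfolding c_def by auto
  have sub: "f summable_on smooth_numbers Q" for Q
    by (rule summable_on_subset_banach[OF summable]) (auto simp: smooth_numbers_def)
  define S where "S = infsum f (smooth_numbers (insert p P))"
  have "(f has_sum S) (smooth_numbers (insert p P))"
    unfolding S_def using sub by (rule has_sum_infsum)
  then have "((\<lambda>x. f (case x of (k, m) \<Rightarrow> p ^ k * m)) has_sum S) (UNIV \<times> smooth_numbers P)"
    by (subst has_sum_reindex_bij_betw[OF bij_betw_smooth_numbers_insert])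
       (use insert in auto)
  moreover have "f (p ^ k * m) = f (p ^ k) * f m" if "m \<in> smooth_numbers P" for k m
  proof (rule mult)
    have "\<not> p dvd m"
      using that pp insert.hyps by (auto simp: smooth_numbers_def prime_factors_dvd)
    then show "coprime (p ^ k) m" using pp by (auto intro: prime_imp_coprime)
  qed (use that pp in \<open>auto simp: smooth_numbers_def prime_gt_0_nat\<close>)
  ultimately have "((\<lambda>(k, m). f (p ^ k) * f m) has_sum S) (UNIV \<times> smooth_numbers P)"
    by (subst (asm) has_sum_cong[where g = "\<lambda>(k, m). f (p ^ k) * f m"]) auto
  then have "((\<lambda>k. f (p ^ k) * c) has_sum S) UNIV"
    by (rule has_sum_Sigma') (use has_sum_cmult_right[OF IH] in auto)
  then have "S = (\<Sum>\<^sub>\<infinity>k. f (p ^ k) * c)" by (simp add: infsumI)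
  also have "\<dots> = (\<Sum>\<^sub>\<infinity>k. f (p ^ k)) * c"
  proof (rule infsum_cmult_left)
    have "inj_on ((^) p) UNIV"
      using pp by (auto intro!: injI simp: prime_nat_iff power_inject_exp)
    moreover have "f summable_on range ((^) p)"
      by (rule summable_on_subset_banach[OF summable]) (use pp in \<open>auto simp: prime_gt_0_nat\<close>)
    ultimately show "(\<lambda>k. f (p ^ k)) summable_on UNIV"
      by (simp add: summable_on_reindex o_def)
  qed
  finally show ?case
    using has_sum_infsum[OF sub, of "insert p P"] insert.hyps by (simp add: S_def c_def)
qed

text \<open>
  All numbers up to \<open>N\<close> are smooth over the primes up to \<open>N\<close>. So the finite product over these
  primes differs from the full sum by at most the absolute tail beyond any given finite set
  \<open>F\<close>, once \<open>N\<close> exceeds the elements of \<open>F\<close>.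
\<close>

lemma euler_product:
  fixes f :: "nat \<Rightarrow> real"
  assumes one: "f 1 = 1"
    and mult: "\<And>a b. a > 0 \<Longrightarrow> b > 0 \<Longrightarrow> coprime a b \<Longrightarrow> f (a * b) = f a * f b"
    and summable: "f summable_on {0<..}"
  shows "(\<lambda>N. \<Prod>p | prime p \<and> p \<le> N. \<Sum>\<^sub>\<infinity>k. f (p ^ k)) \<longlonglongrightarrow> infsum f {0<..}"
proof (rule LIMSEQ_I)
  fix e :: real assume e: "e > 0"
  have abs: "(\<lambda>n. norm (f n)) summable_on {0<..}"
    using summable by (subst summable_on_iff_abs_summable_on_real [symmetric])
  obtain F where F: "finite F" "F \<subseteq> {0<..}"
      "dist (\<Sum>n\<in>F. norm (f n)) (\<Sum>\<^sub>\<infinity>n\<in>{0<..}. norm (f n)) \<le> e / 2"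
    using infsum_finite_approximation[OF abs, of "e/2"] e by auto
  show "\<exists>N0. \<forall>N\<ge>N0. norm ((\<Prod>p | prime p \<and> p \<le> N. \<Sum>\<^sub>\<infinity>k. f (p ^ k)) - infsum f {0<..}) < e"
  proof (intro exI allI impI)
    fix N assume N: "N \<ge> Max (insert 0 F)"
    define A where "A = smooth_numbers {p. prime p \<and> p \<le> N}"
    have A: "(f has_sum (\<Prod>p | prime p \<and> p \<le> N. \<Sum>\<^sub>\<infinity>k. f (p ^ k))) A"
      unfolding A_def by (rule euler_product_finite[OF one mult summable]) auto
    have A0: "A \<subseteq> {0<..}" by (auto simp: A_def smooth_numbers_def)
    have FA: "F \<subseteq> A"
    proof
      fix n assume n: "n \<in> F"
      have "n \<le> Max (insert 0 F)" using F n by (intro Max_ge) auto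
      then have "n \<le> N" using N by simp
      moreover have "n > 0" using F n by auto
      ultimately show "n \<in> A"
        by (auto simp: A_def smooth_numbers_def prime_factors_dvd dest: dvd_imp_le)
    qed
    have D: "(f has_sum (infsum f {0<..} - (\<Prod>p | prime p \<and> p \<le> N. \<Sum>\<^sub>\<infinity>k. f (p ^ k)))) ({0<..} - A)"
      by (rule has_sum_Diff[OF has_sum_infsum[OF summable] A A0])
    have absD: "(\<lambda>n. norm (f n)) summable_on B" if "B \<subseteq> {0<..}" for B
      by (rule summable_on_subset_banach[OF abs that])
    have "norm (infsum f {0<..} - (\<Prod>p | prime p \<and> p \<le> N. \<Sum>\<^sub>\<infinity>k. f (p ^ k)))
            \<le> (\<Sum>\<^sub>\<infinity>n\<in>{0<..} - A. norm (f n))"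
      using norm_infsum_bound[OF absD[of "{0<..} - A"]] infsumI[OF D] by simp
    also have "\<dots> \<le> (\<Sum>\<^sub>\<infinity>n\<in>{0<..} - F. norm (f n))"
      using FA by (intro infsum_mono_neutral absD) auto
    also have "\<dots> = (\<Sum>\<^sub>\<infinity>n\<in>{0<..}. norm (f n)) - (\<Sum>n\<in>F. norm (f n))"
      using F by (subst infsum_Diff[OF abs absD]) auto
    also have "\<dots> \<le> e / 2" using F(3) unfolding dist_real_def by linarith
    also have "\<dots> < e" using e by simp
    finally show "norm ((\<Prod>p | prime p \<and> p \<le> N. \<Sum>\<^sub>\<infinity>k. f (p ^ k)) - infsum f {0<..}) < e"
      by (simp add: norm_minus_commute)
  qed
qed

lemma infsum_geometric:
  assumes "\<bar>x\<bar> < (1::real)"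
  shows "(\<Sum>\<^sub>\<infinity>k. x ^ k) = 1 / (1 - x)"
  by (intro infsumI norm_summable_imp_has_sum)
     (use assms geometric_sums[of x] in \<open>auto simp: power_abs intro!: summable_geometric\<close>)

lemma summable_zeta:
  assumes "s \<ge> 2"
  shows "(\<lambda>n. 1 / real n ^ s) summable_on {0<..}"
proof (rule summable_on_subset_banach[OF norm_summable_imp_summable_on])
  show "summable (\<lambda>n. norm (1 / real n ^ s))"
    using inverse_power_summable[OF assms, where 'a = real] by (simp add: inverse_eq_divide)
qed auto

lemma euler_product_zeta:
  assumes "s \<ge> 2"
  shows "(\<lambda>N. \<Prod>p | prime p \<and> p \<le> N. 1 / (1 - 1 / real p ^ s))
           \<longlonglongrightarrow> (\<Sum>\<^sub>\<infinity>n\<in>{0<..}. 1 / real n ^ s)"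
proof -
  have "(\<Sum>\<^sub>\<infinity>k. 1 / real (p ^ k) ^ s) = 1 / (1 - 1 / real p ^ s)" if "prime p" for p
  proof -
    have "1 / real p ^ s < 1"
      using prime_gt_1_nat[OF that] assms by (simp add: one_less_power)
    moreover have "1 / real (p ^ k) ^ s = (1 / real p ^ s) ^ k" for k
      by (simp add: power_divide power_mult [symmetric] mult.commute)
    ultimately show ?thesis using infsum_geometric[of "1 / real p ^ s"] by simp
  qed
  then have "(\<Prod>p | prime p \<and> p \<le> N. \<Sum>\<^sub>\<infinity>k. 1 / real (p ^ k) ^ s)
          = (\<Prod>p | prime p \<and> p \<le> N. 1 / (1 - 1 / real p ^ s))" for N
    by (intro prod.cong) auto
  then show ?thesis
    using euler_product[of "\<lambda>n. 1 / real n ^ s"] summable_zeta[OF assms]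
    by (simp add: power_mult_distrib)
qed


section \<open>Completely multiplicative functions on the three-free numbers\<close>

text \<open>
  Three-freeness is a condition on each prime separately, and a prime meets only one of two
  coprime factors; hence the indicator function of the three-free numbers is multiplicative.
\<close>

lemma three_free_mult_iff:
  assumes "coprime a b" "a > 0" "b > 0"
  shows "three_free (a * b) \<longleftrightarrow> three_free a \<and> three_free b"
proof -
  have "p ^ 3 dvd a \<or> p ^ 3 dvd b" if p: "prime p" and d: "p ^ 3 dvd a * b" for p
  proof (cases "p dvd a")
    case True
    then have "\<not> p dvd b"
      using p assms(1) by (metis coprime_common_divisor_nat not_prime_1)
    then have "coprime (p ^ 3) b" using p by (auto intro: prime_imp_coprime)
    then show ?thesis using d by (simp add: coprime_dvd_mult_left_iff)
  next
    case False
    then have "coprime (p ^ 3) a" using p by (auto intro: prime_imp_coprime)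
    then show ?thesis using d by (simp add: coprime_dvd_mult_right_iff)
  qed
  then have "(\<exists>p. prime p \<and> p ^ 3 dvd a * b)
      \<longleftrightarrow> (\<exists>p. prime p \<and> p ^ 3 dvd a) \<or> (\<exists>p. prime p \<and> p ^ 3 dvd b)"
    by (blast intro: dvd_mult dvd_mult2)
  then show ?thesis
    using assms(2,3) unfolding three_free_def by simp
qed

lemma three_free_prime_power_iff:
  assumes "prime p"
  shows "three_free (p ^ k) \<longleftrightarrow> k < 3"
proof -
  have "3 \<le> k" if "prime q" "q ^ 3 dvd p ^ k" for q
  proof -
    have "q dvd p ^ k" using that(2) by (meson dvd_power dvd_trans zero_less_numeral)
    then have "q = p" using that(1) assms by (meson prime_dvd_power primes_dvd_imp_eq)
    then show ?thesis using that(2) prime_gt_1_nat[OF assms] by (simp only: power_dvd_imp_le)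
  qed
  moreover have "p ^ 3 dvd p ^ k" if "3 \<le> k" using that by (rule le_imp_power_dvd)
  ultimately have "(\<exists>q. prime q \<and> q ^ 3 dvd p ^ k) \<longleftrightarrow> 3 \<le> k"
    using assms by blast
  then show ?thesis
    using prime_gt_0_nat[OF assms] by (auto simp: three_free_def)
qed

text \<open>
  The restriction of \<open>u\<close> to three-free numbers is multiplicative, though no longer completely
  so, and its Euler factor is cut off after the exponent 2.
\<close>

lemma euler_product_three_free:
  fixes u :: "nat \<Rightarrow> real"
  assumes one: "u 1 = 1"
    and mult: "\<And>a b. a > 0 \<Longrightarrow> b > 0 \<Longrightarrow> u (a * b) = u a * u b"
    and summable: "u summable_on {0<..}"
  shows "(\<lambda>N. \<Prod>p | prime p \<and> p \<le> N. 1 + u p + u p ^ 2)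
           \<longlonglongrightarrow> infsum u {n. three_free n}"
proof -
  define h where "h n = (if three_free n then u n else 0)" for n
  have local: "(\<Sum>\<^sub>\<infinity>k. h (p ^ k)) = 1 + u p + u p ^ 2" if p: "prime p" for p
  proof -
    have "(\<Sum>\<^sub>\<infinity>k. h (p ^ k)) = (\<Sum>\<^sub>\<infinity>k\<in>{..<3}. u (p ^ k))"
      by (rule infsum_cong_neutral) (auto simp: h_def three_free_prime_power_iff[OF p])
    also have "\<dots> = 1 + u p + u p ^ 2"
      using one mult[of p p] prime_gt_0_nat[OF p]
      by (simp add: eval_nat_numeral)
    finally show ?thesis .
  qed
  have h_summable: "h summable_on {0<..}"
  proof -
    have "u summable_on {n. three_free n}"
      by (rule summable_on_subset_banach[OF summable]) (auto simp: three_free_def)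
    also have "?this \<longleftrightarrow> ?thesis"
      by (rule summable_on_cong_neutral) (auto simp: h_def three_free_def)
    finally show ?thesis .
  qed
  have h_one: "h 1 = 1"
    using one three_free_prime_power_iff[of 2 0] by (simp add: h_def)
  have h_mult: "h (a * b) = h a * h b" if "a > 0" "b > 0" "coprime a b" for a b
    using that by (simp add: h_def three_free_mult_iff mult)
  have "(\<lambda>N. \<Prod>p | prime p \<and> p \<le> N. \<Sum>\<^sub>\<infinity>k. h (p ^ k)) \<longlonglongrightarrow> infsum h {0<..}"
    by (rule euler_product[OF h_one h_mult h_summable])
  also have "(\<lambda>N. \<Prod>p | prime p \<and> p \<le> N. \<Sum>\<^sub>\<infinity>k. h (p ^ k))
           = (\<lambda>N. \<Prod>p | prime p \<and> p \<le> N. 1 + u p + u p ^ 2)"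
    by (intro ext prod.cong) (auto simp: local)
  also have "infsum h {0<..} = infsum u {n. three_free n}"
    by (rule infsum_cong_neutral) (auto simp: h_def three_free_def)
  finally show ?thesis .
qed

text \<open>
  In this form \<open>\<mu>\<^sub>3\<close> is visibly the restriction of a completely multiplicative function, the
  Liouville function, as prime factorization turns products into sums of multisets.
\<close>

lemma mu3_three_free:
  assumes "three_free n"
  shows "mu3 n = (-1) ^ size (prime_factorization n)"
proof -
  have "(\<Sum>p\<in>prime_factors n. multiplicity p n) = size (prime_factorization n)"
    unfolding size_multiset_overloaded_eq
    by (intro sum.cong) (auto simp: count_prime_factorization_prime dest: in_prime_factors_imp_prime)
  then show ?thesis using assms by (simp add: mu3_def three_free_def)
qed

text \<open>
  The identity holds already for the partial Euler products, factor by factor, since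
  \<open>(1 + x + x\<^sup>2) (1 - x + x\<^sup>2) (1 - x\<^sup>2) = 1 - x\<^sup>6\<close> for \<open>x = p\<^sup>-\<^sup>s\<close>. It then passes to the limit.
\<close>

theorem three_free_sums_eq_zeta_quotient:
  assumes "s \<ge> 2"
  shows "(\<Sum>\<^sub>\<infinity>n\<in>{n. three_free n}. 1 / real n ^ s) *
         (\<Sum>\<^sub>\<infinity>n\<in>{n. three_free n}. real_of_int (mu3 n) / real n ^ s) *
         (\<Sum>\<^sub>\<infinity>n\<in>{0<..}. 1 / real n ^ (6 * s)) = (\<Sum>\<^sub>\<infinity>n\<in>{0<..}. 1 / real n ^ (2 * s))"
proof -
  \<comment> \<open>the Liouville function, weighted by \<open>n\<^sup>-\<^sup>s\<close>\<close>
  define u where "u n = (-1) ^ size (prime_factorization n) / real n ^ s" for n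
  have "(\<lambda>n. norm (u n)) summable_on {0<..}"
    using summable_zeta[OF assms] by (simp add: u_def abs_div power_abs)
  then have u_summable: "u summable_on {0<..}"
    by (rule abs_summable_summable)
  have "(\<lambda>N. \<Prod>p | prime p \<and> p \<le> N. 1 + 1 / real p ^ s + (1 / real p ^ s) ^ 2)
           \<longlonglongrightarrow> (\<Sum>\<^sub>\<infinity>n\<in>{n. three_free n}. 1 / real n ^ s)"
    by (rule euler_product_three_free) (auto simp: power_mult_distrib summable_zeta assms)
  moreover have "(\<lambda>N. \<Prod>p | prime p \<and> p \<le> N. 1 + u p + u p ^ 2)
           \<longlonglongrightarrow> infsum u {n. three_free n}"
    by (rule euler_product_three_free)
       (simp_all add: u_summable, simp_all add: u_def power_mult_distrib prime_factorization_mult power_add)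
  ultimately have "(\<lambda>N. (\<Prod>p | prime p \<and> p \<le> N. 1 + 1 / real p ^ s + (1 / real p ^ s) ^ 2) *
        (\<Prod>p | prime p \<and> p \<le> N. 1 + u p + u p ^ 2) *
        (\<Prod>p | prime p \<and> p \<le> N. 1 / (1 - 1 / real p ^ (6 * s))))
      \<longlonglongrightarrow> (\<Sum>\<^sub>\<infinity>n\<in>{n. three_free n}. 1 / real n ^ s) * infsum u {n. three_free n} *
         (\<Sum>\<^sub>\<infinity>n\<in>{0<..}. 1 / real n ^ (6 * s))"
    using euler_product_zeta[of "6 * s"] assms by (intro tendsto_mult) auto
  also have "(\<lambda>N. (\<Prod>p | prime p \<and> p \<le> N. 1 + 1 / real p ^ s + (1 / real p ^ s) ^ 2) *
        (\<Prod>p | prime p \<and> p \<le> N. 1 + u p + u p ^ 2) *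
        (\<Prod>p | prime p \<and> p \<le> N. 1 / (1 - 1 / real p ^ (6 * s))))
      = (\<lambda>N. \<Prod>p | prime p \<and> p \<le> N. 1 / (1 - 1 / real p ^ (2 * s)))"
    unfolding prod.distrib [symmetric]
  proof (intro ext prod.cong refl)
    fix N p :: nat assume "p \<in> {p. prime p \<and> p \<le> N}"
    then have p: "prime p" by simp
    define x where "x = 1 / real p ^ s"
    have "u p = - x" using p by (simp add: u_def x_def prime_factorization_prime)
    have "real p ^ s > 1"
      using prime_gt_1_nat[OF p] assms by (intro one_less_power) auto
    then have x: "0 < x" "x < 1" using prime_gt_0_nat[OF p] by (simp_all add: x_def)
    have "x ^ 2 < 1" "x ^ 6 < 1" using x by (simp_all add: power_less_one_iff)
    moreover have "(1 + x + x ^ 2) * (1 + - x + (- x) ^ 2) * (1 - x ^ 2) = 1 - x ^ 6"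
      by algebra
    ultimately have "(1 + x + x ^ 2) * (1 + - x + (- x) ^ 2) * (1 / (1 - x ^ 6)) = 1 / (1 - x ^ 2)"
      by (simp only: frac_eq_eq times_divide_eq_right mult_1_right mult_1_left)
    moreover have "1 / real p ^ (6 * s) = x ^ 6" "1 / real p ^ (2 * s) = x ^ 2"
      by (simp_all add: x_def power_divide power_mult [symmetric] mult.commute)
    ultimately show "(1 + 1 / real p ^ s + (1 / real p ^ s) ^ 2) * (1 + u p + u p ^ 2) *
        (1 / (1 - 1 / real p ^ (6 * s))) = 1 / (1 - 1 / real p ^ (2 * s))"
      unfolding \<open>u p = - x\<close> by (simp only: x_def [symmetric])
  qed
  also have "infsum u {n. three_free n}
      = (\<Sum>\<^sub>\<infinity>n\<in>{n. three_free n}. real_of_int (mu3 n) / real n ^ s)"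
    by (rule infsum_cong) (auto simp: u_def mu3_three_free)
  finally show ?thesis
    by (rule LIMSEQ_unique[OF _ euler_product_zeta]) (use assms in auto)
qed

section \<open>Zeta values at even integers\<close>

lemma Gamma_reflection_real:
  "Gamma x * Gamma (1 - x) = pi / sin (pi * x)" for x :: real
proof -
  have "complex_of_real (Gamma x * Gamma (1 - x))
      = Gamma (complex_of_real x) * Gamma (1 - complex_of_real x)"
    by (simp flip: Gamma_complex_of_real)
  also have "\<dots> = of_real pi / sin (of_real pi * of_real x)"
    by (rule Gamma_reflection_complex)
  also have "\<dots> = complex_of_real (pi / sin (pi * x))"
    by (simp flip: sin_of_real)
  finally have "complex_of_real (Gamma x * Gamma (1 - x)) = complex_of_real (pi / sin (pi * x))" .
  then show ?thesis by (simp only: of_real_eq_iff)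
qed

text \<open>
  Both sides of the reflection formula \<open>\<Gamma>(x) \<Gamma>(1 - x) = \<pi> / sin (\<pi> x)\<close> are differentiated and
  divided by their common value.
\<close>

lemma Digamma_reflection_real:
  assumes "0 < x" "x < (1 :: real)"
  shows "Digamma (1 - x) - Digamma x = pi * cot (pi * x)"
proof -
  have nz: "sin (pi * t) \<noteq> 0" if "t \<in> {0<..<1}" for t
    using that by (intro less_imp_neq[THEN not_sym] sin_gt_zero) auto
  have nonint: "x \<notin> \<int>\<^sub>\<le>\<^sub>0" "1 - x \<notin> \<int>\<^sub>\<le>\<^sub>0"
    using assms by (auto elim!: nonpos_Ints_cases')
  have "((\<lambda>t. Gamma t * Gamma (1 - t)) has_field_derivative
          Gamma x * Gamma (1 - x) * (Digamma x - Digamma (1 - x))) (at x)"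
    using nonint by (auto intro!: derivative_eq_intros simp: algebra_simps)
  moreover have "((\<lambda>t. Gamma t * Gamma (1 - t)) has_field_derivative
          - (pi\<^sup>2 * cos (pi * x) / sin (pi * x) ^ 2)) (at x)"
    unfolding Gamma_reflection_real using nz[of x] assms
    by (auto intro!: derivative_eq_intros simp: power2_eq_square)
  ultimately have "pi / sin (pi * x) * (Digamma x - Digamma (1 - x))
      = - (pi\<^sup>2 * cos (pi * x) / sin (pi * x) ^ 2)"
    unfolding Gamma_reflection_real by (rule DERIV_unique)
  then have "Digamma x - Digamma (1 - x) =
      - (pi\<^sup>2 * cos (pi * x) / sin (pi * x) ^ 2) / (pi / sin (pi * x))"
    using nz[of x] assms by (simp add: field_simps)
  also have "\<dots> = - (pi * cot (pi * x))"
    using nz[of x] assms by (simp add: cot_def power2_eq_square)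
  finally show ?thesis by simp
qed

text \<open>
  The series for \<open>\<psi>(1 + x)\<close> and \<open>\<psi>(1 - x)\<close> are subtracted: the harmonic terms cancel and the
  difference is the cotangent by reflection, up to the term \<open>1 / x\<close> from \<open>\<psi>(1 + x) = \<psi>(x) + 1 / x\<close>.
  Working around 1 keeps the arguments positive and produces the sum over \<open>m \<ge> 1\<close>.
\<close>

lemma cot_partial_fractions:
  assumes "0 < x" "x < (1 :: real)"
  shows "((\<lambda>m. x\<^sup>2 / (real m ^ 2 - x\<^sup>2)) has_sum (1 - pi * x * cot (pi * x)) / 2) {0<..}"
proof -
  define t where "t k = x\<^sup>2 / (real (Suc k) ^ 2 - x\<^sup>2)" for k
  have D: "(\<lambda>k. inverse (of_nat (Suc k)) - inverse (z + of_nat k)) sums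
             (Digamma z + euler_mascheroni)" if "z \<noteq> 0" for z :: real
    using summable_sums[OF summable_Digamma[OF that]] by (simp add: Digamma_def)
  have "(\<lambda>k. x / 2 * ((inverse (of_nat (Suc k)) - inverse (1 + x + of_nat k)) -
                 (inverse (of_nat (Suc k)) - inverse (1 - x + of_nat k)))) sums
          (x / 2 * ((Digamma (1 + x) + euler_mascheroni) - (Digamma (1 - x) + euler_mascheroni)))"
    by (intro sums_mult sums_diff D) (use assms in auto)
  also have "(\<lambda>k. x / 2 * ((inverse (of_nat (Suc k)) - inverse (1 + x + of_nat k)) -
                 (inverse (of_nat (Suc k)) - inverse (1 - x + of_nat k)))) = t"
  proof
    fix k
    have "1 + x + real k \<noteq> 0" "1 - x + real k \<noteq> 0" using assms by auto
    moreover have "real (Suc k) ^ 2 - x\<^sup>2 = (1 + x + real k) * (1 - x + real k)"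
      by (simp add: power2_eq_square algebra_simps)
    ultimately show "x / 2 * ((inverse (of_nat (Suc k)) - inverse (1 + x + of_nat k)) -
                 (inverse (of_nat (Suc k)) - inverse (1 - x + of_nat k))) = t k"
      unfolding t_def by (simp add: divide_simps power2_eq_square) (simp add: algebra_simps)
  qed
  also have "x / 2 * ((Digamma (1 + x) + euler_mascheroni) - (Digamma (1 - x) + euler_mascheroni))
      = (1 - pi * x * cot (pi * x)) / 2"
    using Digamma_plus1[of x] Digamma_reflection_real[OF assms] assms
    by (simp add: add.commute field_simps)
  finally have "t sums ((1 - pi * x * cot (pi * x)) / 2)" .
  moreover have "t k \<ge> 0" for k
    using assms power_mono[of x "real (Suc k)" 2] by (auto simp: t_def)
  ultimately have "(t has_sum ((1 - pi * x * cot (pi * x)) / 2)) UNIV"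
    by (intro sums_nonneg_imp_has_sum) auto
  also have "?this \<longleftrightarrow> ?thesis"
    by (rule has_sum_reindex_bij_witness[of _ "\<lambda>m. m - 1" Suc]) (auto simp: t_def)
  finally show ?thesis .
qed

text \<open>
  Each partial fraction is the geometric series \<open>x\<^sup>2 / (m\<^sup>2 - x\<^sup>2) = \<Sum>j\<ge>1. (x\<^sup>2 / m\<^sup>2)\<^sup>j\<close>. All terms of the
  resulting double series are nonnegative, so the order of summation can be exchanged.
\<close>

lemma zeta_even_generating_function:
  assumes "0 < x" "x < (1 :: real)"
  shows "((\<lambda>j. (\<Sum>\<^sub>\<infinity>m\<in>{0<..}. 1 / real m ^ (2 * j)) * x ^ (2 * j)) has_sum
           (1 - pi * x * cot (pi * x)) / 2) {0<..}"
proof -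
  define g where "g = (\<lambda>(m, j). (x\<^sup>2 / real m ^ 2) ^ j)"
  have inner: "((\<lambda>j. g (m, j)) has_sum x\<^sup>2 / (real m ^ 2 - x\<^sup>2)) {0<..}" if "m \<in> {0<..}" for m
  proof -
    have "x < real m" using assms that by (cases m) auto
    then have "x\<^sup>2 < real m ^ 2" using assms by (intro power_strict_mono) auto
    moreover have "real m ^ 2 > 0" using that by simp
    ultimately have "norm (x\<^sup>2 / real m ^ 2) < 1"
      "(x\<^sup>2 / real m ^ 2) / (1 - x\<^sup>2 / real m ^ 2) = x\<^sup>2 / (real m ^ 2 - x\<^sup>2)"
      by (auto simp: divide_simps)
    moreover have "{0<..} = {1::nat..}" by auto
    ultimately show ?thesis
      using has_sum_geometric_from_1[of "x\<^sup>2 / real m ^ 2"] unfolding g_def prod.case by metis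
  qed
  have "g summable_on {0<..} \<times> {0<..}"
    by (rule summable_on_SigmaI[OF inner])
       (use cot_partial_fractions[OF assms] in \<open>auto simp: g_def intro: has_sum_imp_summable\<close>)
  then have "(g has_sum (1 - pi * x * cot (pi * x)) / 2) ({0<..} \<times> {0<..})"
    by (intro has_sum_SigmaI[OF inner cot_partial_fractions[OF assms]])
  then have "((\<lambda>(j, m). g (m, j)) has_sum (1 - pi * x * cot (pi * x)) / 2) ({0<..} \<times> {0<..})"
    by (subst (asm) has_sum_swap) auto
  moreover have "((\<lambda>m. g (m, j)) has_sum (\<Sum>\<^sub>\<infinity>m\<in>{0<..}. 1 / real m ^ (2 * j)) * x ^ (2 * j)) {0<..}"
    if "j \<in> {0<..}" for j
  proof -
    have "((\<lambda>m. 1 / real m ^ (2 * j) * x ^ (2 * j)) has_sum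
        (\<Sum>\<^sub>\<infinity>m\<in>{0<..}. 1 / real m ^ (2 * j)) * x ^ (2 * j)) {0<..}"
      using that by (intro has_sum_cmult_left has_sum_infsum summable_zeta) auto
    then show ?thesis by (simp add: g_def power_divide power_mult)
  qed
  ultimately show ?thesis
    by (rule has_sum_Sigma'[where f = "\<lambda>(j, m). g (m, j)", simplified]) auto
qed


text \<open>
  The difference of the two series sums to zero near the origin, which the isolation of zeros
  of a power series excludes as soon as some coefficient is nonzero.
\<close>

lemma fps_expansion_unique_real:
  fixes F G :: "real fps"
  assumes "f has_fps_expansion F" "f has_fps_expansion G"
  shows "F = G"
proof (rule ccontr)
  define D where "D = F - G"
  have D: "(\<lambda>x. 0) has_fps_expansion D"
    using has_fps_expansion_diff[OF assms] by (simp add: D_def)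
  then have ev: "eventually (\<lambda>x. x \<in> eball 0 (fps_conv_radius D) \<and> eval_fps D x = 0) (nhds 0)"
    unfolding has_fps_expansion_def
    by (intro eventually_conj eventually_nhds_in_open) (auto simp: zero_ereal_def)
  then obtain r where r: "r > 0"
      "\<And>x. dist x 0 < r \<Longrightarrow> x \<in> eball 0 (fps_conv_radius D) \<and> eval_fps D x = 0"
    unfolding eventually_nhds_metric by blast
  have sm: "(\<lambda>n. fps_nth D n * (x - 0) ^ n) sums 0" if "norm (x - 0) < r" for x
    using sums_eval_fps[of x D] r(2)[of x] that by (simp add: eball_def)
  assume "F \<noteq> G"
  then have "D \<noteq> 0" by (simp add: D_def)
  then obtain m where m: "fps_nth D m \<noteq> 0" unfolding fps_nonzero_nth by blast
  have "fps_nth D 0 = 0"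
    using sm[of 0] r(1) by simp
  with m have "m > 0" by (cases m) auto
  show False
  proof (rule powser_0_nonzero[where f = "\<lambda>_. 0" and \<xi> = 0, OF r(1) sm refl m \<open>m > 0\<close>])
    fix t :: real assume "0 < t" and nz: "\<And>z :: real. z \<in> cball 0 t - {0} \<Longrightarrow> (0 :: real) \<noteq> 0"
    then show False using nz[of t] by auto
  qed auto
qed

text \<open>
  This compares the coefficients of \<open>x\<^sup>2\<^sup>n\<^sup>+\<^sup>1\<close> in
  \<open>f(x) sin (\<pi> x) = (sin (\<pi> x) - \<pi> x cos (\<pi> x)) / 2\<close>, where \<open>f\<close> is the generating function of the
  even zeta values. The alternating sign and the power of \<open>\<pi>\<close> in \<open>c\<close> absorb those of the sine
  coefficients, so that the recurrence has rational coefficients.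
\<close>

lemma zeta_even_recurrence:
  fixes c :: "nat \<Rightarrow> real"
  defines "c \<equiv> (\<lambda>k. (-1) ^ k * (\<Sum>\<^sub>\<infinity>m\<in>{0<..}. 1 / real m ^ (2 * k)) / pi ^ (2 * k))"
  shows "(\<Sum>k=1..n. c k / fact (2 * (n - k) + 1)) = (1 / fact (2 * n + 1) - 1 / fact (2 * n)) / 2"
proof -
  define Z where "Z k = (\<Sum>\<^sub>\<infinity>m\<in>{0<..}. 1 / real m ^ k)" for k
  define F where "F = Abs_fps (\<lambda>i. if even i \<and> i > 0 then Z i else 0)"
  \<comment> \<open>At 0 the cotangent takes the default value 0, which would give \<open>1/2\<close> instead of the limit 0.\<close>
  define f where "f x = (if x = 0 then 0 else (1 - pi * x * cot (pi * x)) / 2)" for x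
  have pos: "(\<lambda>i. fps_nth F i * x ^ i) sums f x" if x: "0 < x" "x < 1" for x
  proof (rule has_sum_imp_sums)
    have "((\<lambda>j. Z (2 * j) * x ^ (2 * j)) has_sum f x) {0<..}"
      using zeta_even_generating_function[OF x] x by (simp add: Z_def f_def)
    also have "?this \<longleftrightarrow> ((\<lambda>i. Z i * x ^ i) has_sum f x) {i. even i \<and> i > 0}"
      by (rule has_sum_reindex_bij_witness[of _ "\<lambda>i. i div 2" "\<lambda>j. 2 * j"]) auto
    also have "\<dots> \<longleftrightarrow> ((\<lambda>i. fps_nth F i * x ^ i) has_sum f x) UNIV"
      by (rule has_sum_cong_neutral) (auto simp: F_def)
    finally show "((\<lambda>i. fps_nth F i * x ^ i) has_sum f x) UNIV" .
  qed
  \<comment> \<open>A power series expansion needs a full neighbourhood of 0; negative \<open>x\<close> follow by evenness.\<close>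
  have sums: "(\<lambda>i. fps_nth F i * x ^ i) sums f x" if x: "\<bar>x\<bar> < 1" for x
  proof -
    consider "x > 0" | "x = 0" | "x < 0" by linarith
    then show ?thesis
    proof cases
      case 3
      have "fps_nth F i * (-x) ^ i = fps_nth F i * x ^ i" for i
        by (simp add: F_def)
      moreover have "f (-x) = f x" by (simp add: f_def)
      ultimately show ?thesis using pos[of "-x"] 3 x by (simp only: abs_less_iff)
    qed (use pos[of x] x in \<open>simp_all add: f_def F_def\<close>)
  qed
  have "f has_fps_expansion F"
  proof (rule has_fps_expansionI)
    have "eventually (\<lambda>x. x \<in> ball 0 (1::real)) (nhds 0)"
      by (intro eventually_nhds_in_open) auto
    then show "eventually (\<lambda>x. (\<lambda>i. fps_nth F i * x ^ i) sums f x) (nhds 0)"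
      by eventually_elim (use sums in \<open>auto simp: dist_real_def\<close>)
  qed
  then have lhs: "(\<lambda>x. f x * sin (pi * x)) has_fps_expansion F * fps_sin pi"
    by (intro fps_expansion_intros)
  have rhs: "(\<lambda>x. 1 / 2 * (sin (pi * x) - pi * (x * cos (pi * x))))
      has_fps_expansion fps_const (1 / 2) * (fps_sin pi - fps_const pi * (fps_X * fps_cos pi))"
    by (intro fps_expansion_intros)
  have "eventually (\<lambda>x. f x * sin (pi * x) = 1 / 2 * (sin (pi * x) - pi * (x * cos (pi * x)))) (nhds 0)"
  proof -
    have "eventually (\<lambda>x. x \<in> ball 0 (1::real)) (nhds 0)"
      by (intro eventually_nhds_in_open) auto
    then show ?thesis
    proof eventually_elim
      case (elim x)
      have "sin (pi * x) \<noteq> 0" if "x \<noteq> 0"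
      proof -
        have "0 < pi * \<bar>x\<bar>" "pi * \<bar>x\<bar> < pi" using elim that by (auto simp: dist_real_def)
        then have "sin (pi * \<bar>x\<bar>) > 0" by (rule sin_gt_zero)
        then show ?thesis by (auto simp: abs_if split: if_splits)
      qed
      then show ?case by (auto simp: f_def cot_def field_simps)
    qed
  qed
  then have "(\<lambda>x. 1 / 2 * (sin (pi * x) - pi * (x * cos (pi * x)))) has_fps_expansion F * fps_sin pi"
    by (rule has_fps_expansion_cong[OF _ refl, THEN iffD1, OF _ lhs])
  then have "F * fps_sin pi = fps_const (1 / 2) * (fps_sin pi - fps_const pi * (fps_X * fps_cos pi))"
    using rhs by (rule fps_expansion_unique_real)
  then have "fps_nth (F * fps_sin pi) (2 * n + 1) =
      fps_nth (fps_const (1 / 2) * (fps_sin pi - fps_const pi * (fps_X * fps_cos pi))) (2 * n + 1)"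
    by simp
  also have "\<dots> = (-1) ^ n * pi ^ (2 * n + 1) * ((1 / fact (2 * n + 1) - 1 / fact (2 * n)) / 2)"
    by (simp add: fps_sin_def fps_cos_def algebra_simps del: fact_Suc)
  also have "fps_nth (F * fps_sin pi) (2 * n + 1) =
      (\<Sum>i=0..2*n+1. fps_nth F i * fps_nth (fps_sin pi) (2 * n + 1 - i))"
    by (simp only: fps_mult_nth)
  also have "\<dots> = (\<Sum>i\<in>(\<lambda>k. 2 * k) ` {1..n}. fps_nth F i * fps_nth (fps_sin pi) (2 * n + 1 - i))"
  proof (rule sum.mono_neutral_right)
    show "\<forall>i\<in>{0..2*n+1} - (\<lambda>k. 2 * k) ` {1..n}. fps_nth F i * fps_nth (fps_sin pi) (2 * n + 1 - i) = 0"
      by (auto simp: F_def elim!: evenE)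
  qed auto
  also have "\<dots> = (\<Sum>k=1..n. fps_nth F (2 * k) * fps_nth (fps_sin pi) (2 * n + 1 - 2 * k))"
    by (subst sum.reindex) (auto simp: inj_on_def)
  also have "\<dots> = (\<Sum>k=1..n. (-1) ^ n * pi ^ (2 * n + 1) * (c k / fact (2 * (n - k) + 1)))"
  proof (rule sum.cong)
    fix k assume k: "k \<in> {1..n}"
    define d where "d = n - k"
    have n: "n = d + k" using k by (simp add: d_def)
    have i: "2 * n + 1 - 2 * k = 2 * d + 1" using n by simp
    have "fps_nth F (2 * k) * fps_nth (fps_sin pi) (2 * n + 1 - 2 * k)
        = Z (2 * k) * ((-1) ^ d * pi ^ (2 * d + 1) / fact (2 * d + 1))"
      unfolding i using k by (simp add: F_def fps_sin_def del: fact_Suc)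
    also have "\<dots> = (-1) ^ n * pi ^ (2 * n + 1) * (c k / fact (2 * d + 1))"
      by (simp add: c_def Z_def n power_add del: fact_Suc)
    finally show "fps_nth F (2 * k) * fps_nth (fps_sin pi) (2 * n + 1 - 2 * k)
        = (-1) ^ n * pi ^ (2 * n + 1) * (c k / fact (2 * (n - k) + 1))"
      by (simp add: d_def)
  qed auto
  also have "\<dots> = (-1) ^ n * pi ^ (2 * n + 1) * (\<Sum>k=1..n. c k / fact (2 * (n - k) + 1))"
    by (simp add: sum_distrib_left)
  finally show ?thesis by simp
qed

lemma
  shows zeta_6: "(\<Sum>\<^sub>\<infinity>m\<in>{0<..}. 1 / real m ^ 6) = pi ^ 6 / 945"
    and zeta_18: "(\<Sum>\<^sub>\<infinity>m\<in>{0<..}. 1 / real m ^ 18) = 43867 * pi ^ 18 / 38979295480125"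
proof -
  define c where "c k = (-1) ^ k * (\<Sum>\<^sub>\<infinity>m\<in>{0<..}. 1 / real m ^ (2 * k)) / pi ^ (2 * k)" for k
  have rec: "(\<Sum>k=1..n. c k / fact (2 * (n - k) + 1)) = (1 / fact (2 * n + 1) - 1 / fact (2 * n)) / 2" for n
    unfolding c_def by (rule zeta_even_recurrence)
  have c1: "c 1 = - 1 / 6"
    using rec[of 1] by (simp add: fact_numeral)
  have c2: "c 2 = 1 / 90"
  proof -
    have "{1..2::nat} = {1, 2}" by auto
    then show ?thesis using rec[of 2] by (simp add: fact_numeral c1[simplified])
  qed
  have c3: "c 3 = - 1 / 945"
  proof -
    have "{1..3::nat} = {1, 2, 3}" by auto
    then show ?thesis using rec[of 3] by (simp add: fact_numeral c1[simplified] c2)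
  qed
  have c4: "c 4 = 1 / 9450"
  proof -
    have "{1..4::nat} = {1, 2, 3, 4}" by auto
    then show ?thesis using rec[of 4] by (simp add: fact_numeral c1[simplified] c2 c3)
  qed
  have c5: "c 5 = - 1 / 93555"
  proof -
    have "{1..5::nat} = {1, 2, 3, 4, 5}" by auto
    then show ?thesis using rec[of 5] by (simp add: fact_numeral c1[simplified] c2 c3 c4)
  qed
  have c6: "c 6 = 691 / 638512875"
  proof -
    have "{1..6::nat} = {1, 2, 3, 4, 5, 6}" by auto
    then show ?thesis using rec[of 6] by (simp add: fact_numeral c1[simplified] c2 c3 c4 c5)
  qed
  have c7: "c 7 = - 2 / 18243225"
  proof -
    have "{1..7::nat} = {1, 2, 3, 4, 5, 6, 7}" by auto
    then show ?thesis using rec[of 7] by (simp add: fact_numeral c1[simplified] c2 c3 c4 c5 c6)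
  qed
  have c8: "c 8 = 3617 / 325641566250"
  proof -
    have "{1..8::nat} = {1, 2, 3, 4, 5, 6, 7, 8}" by auto
    then show ?thesis using rec[of 8] by (simp add: fact_numeral c1[simplified] c2 c3 c4 c5 c6 c7)
  qed
  have c9: "c 9 = - 43867 / 38979295480125"
  proof -
    have "{1..9::nat} = {1, 2, 3, 4, 5, 6, 7, 8, 9}" by auto
    then show ?thesis using rec[of 9] by (simp add: fact_numeral c1[simplified] c2 c3 c4 c5 c6 c7 c8)
  qed
  show "(\<Sum>\<^sub>\<infinity>m\<in>{0<..}. 1 / real m ^ 6) = pi ^ 6 / 945"
    using c3 by (simp add: c_def field_simps)
  show "(\<Sum>\<^sub>\<infinity>m\<in>{0<..}. 1 / real m ^ 18) = 43867 * pi ^ 18 / 38979295480125"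
    using c9 by (simp add: c_def field_simps)
qed

theorem theorem1p2:
  "(\<Sum>\<^sub>\<infinity>n\<in>{n. three_free n}. 1 / real n ^ 3) *
   (\<Sum>\<^sub>\<infinity>n\<in>{n. three_free n}. real_of_int (mu3 n) / real n ^ 3)
     = 41247931725 / (43867 * pi ^ 12)"
proof -
  define a where "a = (\<Sum>\<^sub>\<infinity>n\<in>{n. three_free n}. 1 / real n ^ 3)"
  define b where "b = (\<Sum>\<^sub>\<infinity>n\<in>{n. three_free n}. real_of_int (mu3 n) / real n ^ 3)"
  \<comment> \<open>Opaque names keep the simplifier from merging the powers of \<open>\<pi>\<close> again.\<close>
  define u v where "u = pi ^ 6" and "v = pi ^ 12"
  have "u \<noteq> 0" "v \<noteq> 0" by (simp_all add: u_def v_def)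
  moreover have "pi ^ 18 = u * v" using power_add[of pi 6 12] by (simp add: u_def v_def)
  then have "a * b * (43867 * (u * v) / 38979295480125) = u / 945"
    using three_free_sums_eq_zeta_quotient[of 3] by (simp add: zeta_6 zeta_18 a_def b_def u_def)
  ultimately have "a * b = 41247931725 / (43867 * v)"
    by (simp add: field_simps)
  then show ?thesis by (simp only: a_def b_def v_def)
qed

end
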